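(* For each $n\ge 2$ let $A_n$ and $B_n$ be two independent uniformly random vertices of $T_n$ (that is, independent uniform elements of $[n]$, independent of $T_n$). Then $$\liminf_{n\to\infty}\mathbf{P}\{d_n(A_n,B_n)=2\}>0\quad\text{and}\quad \liminf_{n\to\infty}\mathbf{P}\{d_n(1,A_n)\le 2\}>0 .$$
   Context: The random friend tree process $(T_n)_{n\ge 2}$ is defined as follows. $T_2$ is a single edge joining vertices labelled $1$ and $2$. For $n\ge 2$, given $T_n$ (and the past of the process), $V_n$ is chosen uniformly at random in $\{1,\dots,n\}$, and then $W_n$ is a uniformly random neighbour of $V_n$ in $T_n$; $T_{n+1}$ is obtained from $T_n$ by adding a new vertex labelled $n+1$ joined by an edge to $W_n$. Thus $T_n$ is a tree with vertex set $[n]=\{1,\dots,n\}$. For $i,j\in[n]$, $d_n(i,j)$ is the graph distance between $i$ and $j$ in $T_n$. *)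

theory Defs
  imports "HOL-Probability.Probability"
begin

text \<open>A simple graph on vertices of type \<open>'v\<close> is given by its set of edges, an edge being an
  unordered pair \<open>{u, v}\<close> with \<open>u \<noteq> v\<close>.\<close>

type_synonym 'v edges = "'v set set"

definition neighbours :: "'v edges \<Rightarrow> 'v \<Rightarrow> 'v set" where
  "neighbours T v = {w. {v, w} \<in> T}"

definition adj :: "'v edges \<Rightarrow> ('v \<times> 'v) set" where
  "adj T = {(u, v). {u, v} \<in> T}"

text \<open>\<open>(u, v) \<in> adj T ^^ k\<close> says that there is a walk of length \<open>k\<close> from \<open>u\<close> to \<open>v\<close>;
  the distance is \<open>\<infinity>\<close> when there is none.\<close>

definition graph_dist :: "'v edges \<Rightarrow> 'v \<Rightarrow> 'v \<Rightarrow> enat" where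
  "graph_dist T u v = (INF k \<in> {k. (u, v) \<in> adj T ^^ k}. enat k)"

definition friend_step :: "nat \<Rightarrow> nat edges \<Rightarrow> nat edges pmf" where
  "friend_step n T =
     do {
       v \<leftarrow> pmf_of_set {1..n};
       w \<leftarrow> pmf_of_set (neighbours T v);
       return_pmf (insert {w, Suc n} T)
     }"

text \<open>\<open>friend_tree n\<close> is the law of \<open>T\<^sub>n\<close>, obtained by iterating the transition kernels
  \<open>friend_step 2, \<dots>, friend_step (n - 1)\<close> from the single edge \<open>T\<^sub>2\<close>.
  The values at \<open>n < 2\<close> are irrelevant.\<close>

primrec friend_tree :: "nat \<Rightarrow> nat edges pmf" where
  "friend_tree 0 = return_pmf {{1, 2}}"
| "friend_tree (Suc n) =
     (if n < 2 then return_pmf {{1, 2}} else bind_pmf (friend_tree n) (friend_step n))"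

text \<open>\<open>pmf_of_set\<close> is only meaningful for finite nonempty sets. The following facts show that
  both uses in \<open>friend_step\<close> are of this kind, and that \<open>friend_tree n\<close> is supported on trees
  (connected graphs with \<open>n - 1\<close> edges) with vertex set \<open>{1..n}\<close>.\<close>

lemma friend_tree_2: "friend_tree 2 = return_pmf {{1, 2}}"
  by (simp add: numeral_2_eq_2)

lemma neighbours_insert:
  "neighbours (insert {a, b} T) v =
     neighbours T v \<union> (if v = a then {b} else {}) \<union> (if v = b then {a} else {})"
  by (auto simp: neighbours_def doubleton_eq_iff)

lemma friend_tree_support:
  assumes "2 \<le> n" "T \<in> set_pmf (friend_tree n)"
  shows "(\<forall>e\<in>T. e \<subseteq> {1..n} \<and> card e = 2) \<and> (\<forall>v\<in>{1..n}. neighbours T v \<noteq> {}) \<and>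
    finite T \<and> card T = n - 1 \<and> (\<forall>u\<in>{1..n}. \<forall>v\<in>{1..n}. (u, v) \<in> (adj T)\<^sup>*)"
  using assms
proof (induction n arbitrary: T rule: dec_induct)
  case base
  have T: "T = {{1, 2}}" and 12: "{1..2} = {1, 2::nat}"
    using base by (auto simp: friend_tree_2)
  have "(1, 2) \<in> adj T" "(2, 1) \<in> adj T"
    by (auto simp: T adj_def)
  then show ?case
    unfolding 12 by (auto simp: T neighbours_def doubleton_eq_iff)
next
  case (step n)
  from step.prems step.hyps obtain S u w where S: "S \<in> set_pmf (friend_tree n)"
    and u: "u \<in> {1..n}" and w: "w \<in> set_pmf (pmf_of_set (neighbours S u))"
    and T: "T = insert {w, Suc n} S"
    by (auto simp: friend_step_def)
  have sub: "\<And>e. e \<in> S \<Longrightarrow> e \<subseteq> {1..n}" and card2: "\<And>e. e \<in> S \<Longrightarrow> card e = 2"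
    and ne: "\<And>v. v \<in> {1..n} \<Longrightarrow> neighbours S v \<noteq> {}"
    and fin: "finite S" and card: "card S = n - 1"
    and conn: "\<And>u v. u \<in> {1..n} \<Longrightarrow> v \<in> {1..n} \<Longrightarrow> (u, v) \<in> (adj S)\<^sup>*"
    using step.IH[OF S] by blast+
  have "neighbours S u \<subseteq> {1..n}"
    using sub by (force simp: neighbours_def)
  then have wn: "w \<in> {1..n}"
    using w ne[OF u] by (metis finite_atLeastAtMost finite_subset set_pmf_of_set subsetD)
  have new: "{w, Suc n} \<notin> S"
    using sub[of "{w, Suc n}"] by auto
  have "adj S \<subseteq> adj T" and bk: "(w, Suc n) \<in> adj T" "(Suc n, w) \<in> adj T"
    by (auto simp: T adj_def insert_commute)
  then have connT: "(x, y) \<in> (adj T)\<^sup>*" if "x \<in> {1..n}" "y \<in> {1..n}" for x y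
    using conn[OF that] rtrancl_mono by blast
  have "(x, y) \<in> (adj T)\<^sup>*" if "x \<in> {1..Suc n}" "y \<in> {1..Suc n}" for x y
  proof -
    have "(x, w) \<in> (adj T)\<^sup>*"
      using connT[of x w] wn that bk by (cases "x = Suc n") auto
    moreover have "(w, y) \<in> (adj T)\<^sup>*"
      using connT[of w y] wn that bk by (cases "y = Suc n") auto
    ultimately show ?thesis by simp
  qed
  moreover have "neighbours T v \<noteq> {}" if "v \<in> {1..Suc n}" for v
    using ne[of v] that unfolding T neighbours_insert by (cases "v = Suc n") auto
  moreover have "e \<subseteq> {1..Suc n} \<and> card e = 2" if "e \<in> T" for e
    using that sub[of e] card2[of e] wn by (fastforce simp: T)
  moreover have "card T = Suc n - 1"
    using fin new card step.hyps by (simp add: T)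
  ultimately show ?case
    using fin by (simp add: T)
qed

end

theory Submission
  imports Defs
begin

text \<open>The vertex \<open>1\<close> collects a number of pendant leaves that grows linearly in expectation. Let
  \<open>L\<close> be the number of leaves attached to a vertex \<open>v\<close> of \<open>T\<^sub>n\<close>. If the chosen vertex \<open>V\<^sub>n\<close> is one
  of these leaves, its only neighbour is \<open>v\<close>, so the new vertex is attached to \<open>v\<close> and becomes
  another such leaf. Conversely a leaf of \<open>v\<close> can only be lost when the new vertex is attached
  to it, which requires \<open>V\<^sub>n = v\<close>. Thus \<open>L\<close> increases with probability at least \<open>L / n\<close> and
  decreases with probability at most \<open>1 / n\<close>, and \<open>G = max (L - 1) 0\<close> satisfies
  \<open>\<E>[G\<^sub>n\<^sub>+\<^sub>1 | T\<^sub>n] \<ge> (1 + 1 / n) G\<^sub>n\<close> (lemma \<open>expectation_surplus_friend_step\<close>). The process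
  \<open>G\<^sub>n / n\<close> is therefore a submartingale. As \<open>T\<^sub>3\<close> is a path whose centre is \<open>1\<close> with probability
  \<open>1 / 2\<close>, it follows that \<open>\<E>[G\<^sub>n / n] \<ge> 1 / 6\<close> for \<open>n \<ge> 3\<close>
  (lemma \<open>expectation_surplus_friend_tree\<close>).

  A uniform vertex is a leaf attached to \<open>1\<close> with conditional probability \<open>L\<^sub>n / n\<close>, which gives
  the second bound. Two different leaves attached to \<open>1\<close> are at distance \<open>2\<close>, and two independent
  uniform vertices are such a pair with conditional probability
  \<open>L\<^sub>n (L\<^sub>n - 1) / n\<^sup>2 \<ge> (G\<^sub>n / n)\<^sup>2\<close>; convexity of the square gives the first bound, with limit
  inferior at least \<open>1 / 36\<close>.\<close>

section \<open>Expectations over finitely supported distributions\<close>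

lemma expectation_bind_pmf_finite:
  fixes h :: "'b \<Rightarrow> real"
  assumes "finite (set_pmf p)" "\<And>x. x \<in> set_pmf p \<Longrightarrow> finite (set_pmf (f x))"
  shows "measure_pmf.expectation (bind_pmf p f) h =
    measure_pmf.expectation p (\<lambda>x. measure_pmf.expectation (f x) h)"
  using assms by (subst pmf_expectation_bind[of "set_pmf p"])
    (auto simp: integral_measure_pmf[of "set_pmf p"])

lemma expectation_mono_pmf_finite:
  fixes f g :: "'a \<Rightarrow> real"
  assumes "finite (set_pmf p)" "\<And>x. x \<in> set_pmf p \<Longrightarrow> f x \<le> g x"
  shows "measure_pmf.expectation p f \<le> measure_pmf.expectation p g"
  using assms by (intro integral_mono_AE integrable_measure_pmf_finite)
    (auto simp: AE_measure_pmf_iff)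

lemma prob_pair_pmf_finite:
  assumes "finite (set_pmf p)" "finite (set_pmf q)"
  shows "measure_pmf.prob (pair_pmf p q) X =
    measure_pmf.expectation p (\<lambda>x. measure_pmf.prob q {y. (x, y) \<in> X})"
proof -
  have prob: "measure_pmf.expectation r (\<lambda>z. of_bool (z \<in> Y)) = measure_pmf.prob r Y"
    for r :: "'c pmf" and Y
  proof -
    have "(\<lambda>z. of_bool (z \<in> Y) :: real) = indicator Y"
      by (auto simp: indicator_def)
    then show ?thesis
      by simp
  qed
  have "measure_pmf.prob (pair_pmf p q) X =
      measure_pmf.expectation (pair_pmf p q) (\<lambda>z. of_bool (z \<in> X))"
    by (rule prob[symmetric])
  also have "\<dots> = measure_pmf.expectation p
      (\<lambda>x. measure_pmf.expectation q (\<lambda>y. of_bool ((x, y) \<in> X)))"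
    using assms by (simp add: pair_pmf_def expectation_bind_pmf_finite)
  also have "\<dots> = measure_pmf.expectation p (\<lambda>x. measure_pmf.prob q {y. (x, y) \<in> X})"
    by (simp flip: prob)
  finally show ?thesis .
qed

lemma pair_pmf_of_set:
  assumes "finite A" "A \<noteq> {}" "finite B" "B \<noteq> {}"
  shows "pair_pmf (pmf_of_set A) (pmf_of_set B) = pmf_of_set (A \<times> B)"
proof (rule pmf_eqI)
  fix z
  show "pmf (pair_pmf (pmf_of_set A) (pmf_of_set B)) z = pmf (pmf_of_set (A \<times> B)) z"
    using assms by (cases z) (auto simp: pmf_pair pmf_of_set indicator_def card_cartesian_product)
qed

section \<open>Pendant leaves\<close>

definition pendant :: "'v edges \<Rightarrow> 'v \<Rightarrow> 'v set" where
  "pendant T v = {u. neighbours T u = {v}}"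

text \<open>Truncated subtraction makes this quantity vanish also in the absence of leaves. Removing
  one leaf from the count turns the mean increment \<open>(L - 1) / n\<close> into a multiple of the quantity
  itself.\<close>

definition surplus :: "'v edges \<Rightarrow> 'v \<Rightarrow> nat" where
  "surplus T v = card (pendant T v) - 1"

lemma neighbours_sym: "u \<in> neighbours T v \<longleftrightarrow> v \<in> neighbours T u"
  by (simp add: neighbours_def insert_commute)

lemma friend_tree_neighbours:
  assumes "2 \<le> n" "T \<in> set_pmf (friend_tree n)"
  shows "neighbours T v \<subseteq> {1..n}" "v \<notin> neighbours T v"
    "v \<in> {1..n} \<Longrightarrow> neighbours T v \<noteq> {}"
    "neighbours T v \<noteq> {} \<Longrightarrow> v \<in> {1..n}"
proof -
  have e: "e \<subseteq> {1..n}" "card e = 2" if "e \<in> T" for e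
    using friend_tree_support[OF assms] that by blast+
  show "neighbours T v \<subseteq> {1..n}" "neighbours T v \<noteq> {} \<Longrightarrow> v \<in> {1..n}"
    using e(1) by (fastforce simp: neighbours_def)+
  show "v \<notin> neighbours T v"
    using e(2)[of "{v}"] by (auto simp: neighbours_def)
  show "v \<in> {1..n} \<Longrightarrow> neighbours T v \<noteq> {}"
    using friend_tree_support[OF assms] by blast
qed

lemma pendant_subset:
  assumes "2 \<le> n" "T \<in> set_pmf (friend_tree n)"
  shows "pendant T v \<subseteq> {1..n}"
  using friend_tree_neighbours(4)[OF assms] by (auto simp: pendant_def)

lemma finite_pendant:
  assumes "2 \<le> n" "T \<in> set_pmf (friend_tree n)"
  shows "finite (pendant T v)"
  using pendant_subset[OF assms] finite_subset by blast

lemma pendant_insert: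
  assumes "2 \<le> n" "T \<in> set_pmf (friend_tree n)" "v \<in> {1..n}"
  shows "pendant (insert {w, Suc n} T) v =
    (pendant T v - {w}) \<union> (if w = v then {Suc n} else {})"
proof -
  note nb = friend_tree_neighbours[OF assms(1,2)]
  have "neighbours T (Suc n) = {}"
    using nb(4)[of "Suc n"] by auto
  moreover have "Suc n \<notin> neighbours T u" for u
    using nb(1)[of u] by auto
  ultimately show ?thesis
    using assms(3) nb(3)
    by (auto simp: pendant_def neighbours_insert split: if_splits)
qed

text \<open>A single step, for a fixed choice \<open>u\<close> of the random vertex: a gain is certain if \<open>u\<close> is a leaf
  attached to \<open>v\<close>, and a loss, which is at most \<open>1\<close>, occurs only if \<open>u = v\<close>.\<close>

lemma surplus_insert_ge:
  assumes "2 \<le> n" "T \<in> set_pmf (friend_tree n)" "v \<in> {1..n}" "w \<in> neighbours T u"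
  shows "surplus T v + of_bool (u \<in> pendant T v)
    \<le> surplus (insert {w, Suc n} T) v + of_bool (u = v)"
proof -
  note fin = finite_pendant[OF assms(1,2)]
  note pin = pendant_insert[OF assms(1-3)]
  have nv: "v \<notin> pendant T v"
    using friend_tree_neighbours(2)[OF assms(1,2)] by (auto simp: pendant_def)
  have new: "Suc n \<notin> pendant T v"
    using pendant_subset[OF assms(1,2), of v] by auto
  consider (gain) "u \<in> pendant T v" | (loss) "u = v" | (other) "u \<notin> pendant T v" "u \<noteq> v"
    by blast
  then show ?thesis
  proof cases
    case gain
    then have "w = v"
      using assms(4) by (auto simp: pendant_def)
    then have "card (pendant (insert {w, Suc n} T) v) = Suc (card (pendant T v))"
      using fin nv new by (simp add: pin)
    moreover have "card (pendant T v) > 0"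
      using gain fin by (auto simp: card_gt_0_iff)
    moreover have "u \<noteq> v"
      using gain nv by auto
    ultimately show ?thesis
      by (simp add: surplus_def)
  next
    case loss
    have "card (pendant T v) - 1 \<le> card (pendant T v - {w})"
      using fin by (simp add: card_Diff_singleton_if)
    also have "\<dots> \<le> card (pendant (insert {w, Suc n} T) v)"
      by (intro card_mono) (auto simp: pin fin)
    finally show ?thesis
      using loss nv by (simp add: surplus_def)
  next
    case other
    then have "w \<notin> pendant T v"
      using assms(4) neighbours_sym[of w T u] by (auto simp: pendant_def)
    then have "card (pendant T v) \<le> card (pendant (insert {w, Suc n} T) v)"
      by (intro card_mono) (auto simp: pin fin)
    then show ?thesis
      using other by (simp add: surplus_def)
  qed
qed

section \<open>Linear growth of the number of leaves attached to the first vertex\<close>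

lemma finite_set_friend_step:
  assumes "2 \<le> n" "T \<in> set_pmf (friend_tree n)"
  shows "finite (set_pmf (friend_step n T))"
proof -
  have "finite (neighbours T v)" "v \<in> {1..n} \<Longrightarrow> neighbours T v \<noteq> {}" for v
    using friend_tree_neighbours(1,3)[OF assms] finite_subset by blast+
  then show ?thesis
    using assms(1) by (simp add: friend_step_def)
qed

lemma finite_set_friend_tree: "finite (set_pmf (friend_tree n))"
proof (induction n)
  case (Suc n)
  then show ?case
    by (cases "n < 2") (simp_all add: finite_set_friend_step)
qed simp

text \<open>Averaging \<open>surplus_insert_ge\<close> over the chosen vertex gives a mean increment of at least
  \<open>(L - 1) / n\<close>, where \<open>L\<close> is the number of leaves attached to \<open>v\<close>. For \<open>L = 0\<close> this
  bound is negative, but then the surplus is \<open>0\<close> and cannot decrease.\<close>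

lemma expectation_surplus_friend_step:
  assumes "2 \<le> n" "T \<in> set_pmf (friend_tree n)" "v \<in> {1..n}"
  shows "(1 + 1 / n) * surplus T v \<le>
    measure_pmf.expectation (friend_step n T) (\<lambda>S. real (surplus S v))"
proof (cases "card (pendant T v) = 0")
  case True
  then show ?thesis
    by (simp add: surplus_def)
next
  case False
  note nb = friend_tree_neighbours[OF assms(1,2)]
  let ?G = "real (surplus T v)"
  let ?E = "\<lambda>u. measure_pmf.expectation
    (bind_pmf (pmf_of_set (neighbours T u)) (\<lambda>w. return_pmf (insert {w, Suc n} T)))
    (\<lambda>S. real (surplus S v))"
  have fin: "finite (neighbours T u)" for u
    using nb(1) finite_subset by blast
  have ge: "?G + of_bool (u \<in> pendant T v) - of_bool (u = v) \<le> ?E u" if "u \<in> {1..n}" for u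
  proof -
    have "?G + of_bool (u \<in> pendant T v) - of_bool (u = v) = measure_pmf.expectation
        (pmf_of_set (neighbours T u)) (\<lambda>w. ?G + of_bool (u \<in> pendant T v) - of_bool (u = v))"
      by simp
    also have "\<dots> \<le> measure_pmf.expectation (pmf_of_set (neighbours T u))
        (\<lambda>w. real (surplus (insert {w, Suc n} T) v))"
    proof (rule expectation_mono_pmf_finite)
      show "finite (set_pmf (pmf_of_set (neighbours T u)))"
        using fin nb(3)[OF that] by simp
      fix w
      assume "w \<in> set_pmf (pmf_of_set (neighbours T u))"
      then have "w \<in> neighbours T u"
        using fin nb(3)[OF that] by simp
      from surplus_insert_ge[OF assms this]
      have "real (surplus T v + of_bool (u \<in> pendant T v))
          \<le> real (surplus (insert {w, Suc n} T) v + of_bool (u = v))"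
        by (rule of_nat_mono)
      then show "?G + of_bool (u \<in> pendant T v) - of_bool (u = v)
          \<le> real (surplus (insert {w, Suc n} T) v)"
        by simp
    qed
    also have "\<dots> = ?E u"
      using fin nb(3)[OF that] by (simp add: expectation_bind_pmf_finite)
    finally show ?thesis .
  qed
  have "n * ((1 + 1 / n) * ?G) = n * ?G + card (pendant T v) - 1"
    using False assms(1) by (simp add: surplus_def of_nat_diff field_simps)
  also have "\<dots> = (\<Sum>u = 1..n. ?G + of_bool (u \<in> pendant T v) - of_bool (u = v))"
  proof -
    have "{1..n} \<inter> pendant T v = pendant T v" "{1..n} \<inter> {v} = {v}"
      using pendant_subset[OF assms(1,2), of v] assms(3) by auto
    then show ?thesis
      by (simp add: sum.distrib sum_subtractf sum_of_bool_eq)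
  qed
  also have "\<dots> \<le> (\<Sum>u = 1..n. ?E u)"
    by (intro sum_mono ge) simp
  finally have "n * ((1 + 1 / n) * ?G) \<le> (\<Sum>u = 1..n. ?E u)" .
  moreover have "measure_pmf.expectation (friend_step n T) (\<lambda>S. real (surplus S v))
      = (\<Sum>u = 1..n. ?E u) / n"
    unfolding friend_step_def using assms(1) fin nb(3)
    by (subst expectation_bind_pmf_finite) (auto simp: integral_pmf_of_set)
  ultimately show ?thesis
    using assms(1) by (simp add: pos_le_divide_eq mult.commute)
qed

text \<open>In \<open>T\<^sub>3\<close> the vertex \<open>3\<close> is attached to \<open>2\<close> or to \<open>1\<close>, each with probability \<open>1 / 2\<close>. In the
  second case \<open>1\<close> has the two leaves \<open>2\<close> and \<open>3\<close>. Starting at \<open>T\<^sub>2\<close> would be useless, since there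
  the surplus is \<open>0\<close>.\<close>

lemma expectation_surplus_friend_tree_3:
  "1 / 2 \<le> measure_pmf.expectation (friend_tree 3) (\<lambda>T. real (surplus T 1))"
proof -
  let ?T = "{{1, 2}} :: nat edges"
  have 12: "{1..2} = {1, 2::nat}"
    by auto
  have nb: "neighbours ?T 1 = {2}" "neighbours ?T 2 = {1}"
    by (auto simp: neighbours_def doubleton_eq_iff)
  have "friend_tree 3 = friend_step 2 ?T"
    using friend_tree.simps(2)[of 2]
    by (simp add: friend_tree_2 bind_return_pmf numeral_3_eq_3 numeral_2_eq_2)
  also have "\<dots> = bind_pmf (pmf_of_set {1, 2})
      (\<lambda>v. bind_pmf (pmf_of_set (neighbours ?T v)) (\<lambda>w. return_pmf (insert {w, 3} ?T)))"
    unfolding friend_step_def 12 by simp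
  finally have tree: "friend_tree 3 = \<dots>" .
  have "measure_pmf.expectation (friend_tree 3) (\<lambda>T. real (surplus T 1)) =
      (surplus (insert {2, 3} ?T) 1 + surplus (insert {1, 3} ?T) 1) / 2"
    unfolding tree using nb
    by (subst expectation_bind_pmf_finite)
       (auto simp: integral_pmf_of_set pmf_of_set_singleton bind_return_pmf)
  moreover have "surplus (insert {1, 3} ?T) 1 = 1"
  proof -
    have "pendant (insert {1, 3} ?T) 1 = {2, 3}"
      by (auto simp: pendant_def neighbours_def doubleton_eq_iff)
    then show ?thesis
      by (simp add: surplus_def)
  qed
  ultimately show ?thesis
    by simp
qed

text \<open>The factors \<open>1 + 1 / k = (k + 1) / k\<close> telescope from \<open>k = 3\<close> to \<open>n / 3\<close>.\<close>

lemma expectation_surplus_friend_tree: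
  assumes "3 \<le> n"
  shows "n / 6 \<le> measure_pmf.expectation (friend_tree n) (\<lambda>T. real (surplus T 1))"
  using assms
proof (induction n rule: dec_induct)
  case base
  show ?case
    using expectation_surplus_friend_tree_3 by simp
next
  case (step n)
  have "Suc n / 6 = (1 + 1 / n) * (n / 6)"
    using step.hyps by (simp add: field_simps)
  also have "\<dots> \<le> (1 + 1 / n) *
      measure_pmf.expectation (friend_tree n) (\<lambda>T. real (surplus T 1))"
    using step.IH by (intro mult_left_mono) auto
  also have "\<dots> = measure_pmf.expectation (friend_tree n) (\<lambda>T. (1 + 1 / n) * real (surplus T 1))"
    by simp
  also have "\<dots> \<le> measure_pmf.expectation (friend_tree n)
      (\<lambda>T. measure_pmf.expectation (friend_step n T) (\<lambda>S. real (surplus S 1)))"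
    using step.hyps
    by (intro expectation_mono_pmf_finite finite_set_friend_tree expectation_surplus_friend_step)
       auto
  also have "\<dots> = measure_pmf.expectation (friend_tree (Suc n)) (\<lambda>T. real (surplus T 1))"
    using step.hyps
    by (simp add: expectation_bind_pmf_finite finite_set_friend_tree finite_set_friend_step)
  finally show ?case .
qed

section \<open>Distances between leaves\<close>

lemma graph_dist_le:
  assumes "(u, v) \<in> adj T ^^ k"
  shows "graph_dist T u v \<le> enat k"
  unfolding graph_dist_def using assms by (auto intro: INF_lower)

lemma graph_dist_pendant:
  assumes "u \<in> pendant T v"
  shows "graph_dist T v u \<le> 1"
proof -
  have "v \<in> neighbours T u"
    using assms by (simp add: pendant_def)
  then have "(v, u) \<in> adj T ^^ 1"
    by (simp add: adj_def neighbours_def insert_commute)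
  from graph_dist_le[OF this] show ?thesis
    by (simp add: one_enat_def)
qed

text \<open>Two leaves attached to \<open>v\<close> are joined by a walk of length \<open>2\<close> through \<open>v\<close>. They are not
  adjacent: otherwise the second leaf would be \<open>v\<close>, which would then be its own neighbour.\<close>

lemma graph_dist_pendant_pendant:
  assumes "2 \<le> n" "T \<in> set_pmf (friend_tree n)"
    and "a \<in> pendant T v" "b \<in> pendant T v" "a \<noteq> b"
  shows "graph_dist T a b = 2"
proof (rule antisym)
  have av: "neighbours T a = {v}" and bv: "neighbours T b = {v}"
    using assms(3,4) by (auto simp: pendant_def)
  have "v \<in> neighbours T a" "b \<in> neighbours T v"
    using av bv neighbours_sym[of b T v] by auto
  then have "(a, b) \<in> adj T O adj T"
    by (auto simp: adj_def neighbours_def)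
  then have "(a, b) \<in> adj T ^^ 2"
    by (simp add: numeral_2_eq_2)
  from graph_dist_le[OF this] show "graph_dist T a b \<le> 2"
    by (simp add: numeral_eq_enat)
  have "b \<notin> neighbours T a"
    using av bv friend_tree_neighbours(2)[OF assms(1,2), of v] by auto
  then have "(a, b) \<notin> adj T"
    by (simp add: adj_def neighbours_def)
  then have "2 \<le> k" if "(a, b) \<in> adj T ^^ k" for k
    using that assms(5) by (cases k; cases "k - 1") auto
  then show "2 \<le> graph_dist T a b"
    unfolding graph_dist_def by (intro INF_greatest) (auto simp: numeral_eq_enat)
qed

lemma prob_graph_dist_1_le_2:
  assumes "3 \<le> n"
  shows "1 / 6 \<le> measure_pmf.prob (pair_pmf (friend_tree n) (pmf_of_set {1..n}))
    {(T, a). graph_dist T 1 a \<le> 2}"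
proof -
  have "1 / 6 \<le> measure_pmf.expectation (friend_tree n) (\<lambda>T. real (surplus T 1)) / n"
    using expectation_surplus_friend_tree[OF assms] assms by (simp add: field_simps)
  also have "\<dots> = measure_pmf.expectation (friend_tree n) (\<lambda>T. surplus T 1 / n)"
    by simp
  also have "\<dots> \<le> measure_pmf.expectation (friend_tree n)
      (\<lambda>T. measure_pmf.prob (pmf_of_set {1..n}) {a. (T, a) \<in> {(T, a). graph_dist T 1 a \<le> 2}})"
  proof (rule expectation_mono_pmf_finite[OF finite_set_friend_tree])
    fix T
    assume T: "T \<in> set_pmf (friend_tree n)"
    have "pendant T 1 \<subseteq> {1..n} \<inter> {a. graph_dist T 1 a \<le> 2}"
      using pendant_subset[OF _ T] assms graph_dist_pendant[of _ T 1]
      by (force intro: order_trans[of _ 1 2])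
    then have "card (pendant T 1) \<le> card ({1..n} \<inter> {a. graph_dist T 1 a \<le> 2})"
      by (intro card_mono) auto
    then have "surplus T 1 \<le> card ({1..n} \<inter> {a. graph_dist T 1 a \<le> 2})"
      by (simp add: surplus_def)
    then show "surplus T 1 / n \<le>
        measure_pmf.prob (pmf_of_set {1..n}) {a. (T, a) \<in> {(T, a). graph_dist T 1 a \<le> 2}}"
      using assms by (simp add: measure_pmf_of_set divide_right_mono)
  qed
  also have "\<dots> = measure_pmf.prob (pair_pmf (friend_tree n) (pmf_of_set {1..n}))
      {(T, a). graph_dist T 1 a \<le> 2}"
    using assms by (subst prob_pair_pmf_finite) (auto simp: finite_set_friend_tree)
  finally show ?thesis .
qed

lemma prob_graph_dist_eq_2:
  assumes "3 \<le> n"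
  shows "1 / 36 \<le> measure_pmf.prob
    (pair_pmf (friend_tree n) (pair_pmf (pmf_of_set {1..n}) (pmf_of_set {1..n})))
    {(T, a, b). graph_dist T a b = 2}"
proof -
  let ?X = "{(T, a, b). graph_dist T a b = 2}"
  let ?Q = "pair_pmf (pmf_of_set {1..n}) (pmf_of_set {1..n})"
  have Q: "?Q = pmf_of_set ({1..n} \<times> {1..n})"
    using assms by (intro pair_pmf_of_set) auto
  \<comment> \<open>Convexity of the square, in the form of its tangent line at \<open>1 / 6\<close>.\<close>
  have tangent: "x / 3 - 1 / 36 \<le> x\<^sup>2" for x :: real
    using zero_le_power2[of "x - 1 / 6"] by (simp add: power2_eq_square algebra_simps)
  have "1 / 36 \<le> measure_pmf.expectation (friend_tree n) (\<lambda>T. real (surplus T 1)) / (3 * n) - 1 / 36"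
    using expectation_surplus_friend_tree[OF assms] assms by (simp add: field_simps)
  also have "\<dots> = measure_pmf.expectation (friend_tree n) (\<lambda>T. surplus T 1 / (3 * n) - 1 / 36)"
    by (subst Bochner_Integration.integral_diff)
       (auto intro: integrable_measure_pmf_finite finite_set_friend_tree)
  also have "\<dots> \<le> measure_pmf.expectation (friend_tree n)
      (\<lambda>T. measure_pmf.prob ?Q {y. (T, y) \<in> ?X})"
  proof (rule expectation_mono_pmf_finite[OF finite_set_friend_tree])
    fix T
    assume T: "T \<in> set_pmf (friend_tree n)"
    let ?P = "pendant T 1"
    let ?D = "{1..n} \<times> {1..n} \<inter> {y. (T, y) \<in> ?X}"
    have n: "2 \<le> n"
      using assms by simp
    have "?P \<times> ?P - (\<lambda>a. (a, a)) ` ?P \<subseteq> ?D"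
      using pendant_subset[OF n T, of 1] graph_dist_pendant_pendant[OF n T, of _ 1] by auto
    then have "card (?P \<times> ?P - (\<lambda>a. (a, a)) ` ?P) \<le> card ?D"
      by (intro card_mono) auto
    also have "card (?P \<times> ?P - (\<lambda>a. (a, a)) ` ?P) = card ?P * card ?P - card ?P"
      using finite_pendant[OF n T]
      by (subst card_Diff_subset) (auto simp: card_cartesian_product card_image inj_on_def)
    also have "card ?P * card ?P - card ?P = card ?P * surplus T 1"
      by (simp add: surplus_def diff_mult_distrib2)
    finally have "card ?P * surplus T 1 \<le> card ?D" .
    moreover have "surplus T 1 * surplus T 1 \<le> card ?P * surplus T 1"
      by (intro mult_right_mono) (auto simp: surplus_def)
    ultimately have "(surplus T 1)\<^sup>2 \<le> card ?D"
      unfolding power2_eq_square by (rule order_trans[rotated])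
    then have "real ((surplus T 1)\<^sup>2) \<le> real (card ?D)"
      by (rule of_nat_mono)
    then have "(surplus T 1 / n)\<^sup>2 \<le> card ?D / (n * n)"
      by (simp add: power_divide power2_eq_square divide_right_mono)
    also have "\<dots> = measure_pmf.prob ?Q {y. (T, y) \<in> ?X}"
      unfolding Q using assms by (subst measure_pmf_of_set) (auto simp: card_cartesian_product)
    finally show "surplus T 1 / (3 * n) - 1 / 36 \<le> measure_pmf.prob ?Q {y. (T, y) \<in> ?X}"
      using tangent[of "surplus T 1 / n"] by (simp add: mult.commute)
  qed
  also have "\<dots> = measure_pmf.prob (pair_pmf (friend_tree n) ?Q) ?X"
    using assms by (subst prob_pair_pmf_finite) (auto simp: finite_set_friend_tree)
  finally show ?thesis .
qed

lemma liminf_pos_if_eventually_ge: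
  fixes f :: "nat \<Rightarrow> real"
  assumes "0 < c" "\<And>n. N \<le> n \<Longrightarrow> c \<le> f n"
  shows "liminf (\<lambda>n. ereal (f n)) > 0"
proof -
  have "0 < ereal c"
    using assms(1) by simp
  also have "\<dots> \<le> liminf (\<lambda>n. ereal (f n))"
    using assms(2) by (intro Liminf_bounded) (auto simp: eventually_sequentially)
  finally show ?thesis .
qed

theorem theorem4p1:
  shows "liminf (\<lambda>n. ereal (measure_pmf.prob
            (pair_pmf (friend_tree n) (pair_pmf (pmf_of_set {1..n}) (pmf_of_set {1..n})))
            {(T, a, b). graph_dist T a b = 2})) > 0
       \<and> liminf (\<lambda>n. ereal (measure_pmf.prob
            (pair_pmf (friend_tree n) (pmf_of_set {1..n}))
            {(T, a). graph_dist T 1 a \<le> 2})) > 0"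
  using liminf_pos_if_eventually_ge[OF _ prob_graph_dist_eq_2]
    liminf_pos_if_eventually_ge[OF _ prob_graph_dist_1_le_2]
  by simp

end
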